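(* Let $n,m,p$ be natural numbers, $Q_0,Q_i\in\mathcal S^n$, $c_0,c_i\in\mathbb R^n$, $d_i\in\mathbb R$ for $i\in[m]$, and $a_i\in\mathbb R^n$, $b_i\in\mathbb R$ for $i\in[p]$. Consider the binary quadratically constrained quadratic program in the variable $x$ $$(QCQP)\quad \min\; x^\top Q_0x+c_0^\top x\quad\text{s.t.}\quad x^\top Q_ix+c_i^\top x\le d_i\ \ \forall i\in[m],\quad a_i^\top x=b_i\ \ \forall i\in[p],\quad x\in\{0,1\}^n,$$ and the binary semidefinite program in the variables $x\in\mathbb{R}^n$, $X\in\mathcal S^n$ $$(BSDP_{QCQP})\quad \min\; \langle Q_0,X\rangle+c_0^\top x\quad\text{s.t.}\quad \langle Q_i,X\rangle+c_i^\top x\le d_i\ \ \forall i\in[m],\quad a_i^\top x=b_i\ \ \forall i\in[p],$$ $$\begin{pmatrix}1&x^\top\\ x&X\end{pmatrix}\succeq \mathbf 0,\quad \operatorname{diag}(X)=x,\quad x\in\{0,1\}^n.$$ Then $(BSDP_{QCQP})$ is equivalent to $(QCQP)$.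
   Context: $[m]=\{1,\dots,m\}$; $\mathcal S^n$ is the set of real symmetric $n\times n$ matrices; $\langle X,Y\rangle=\operatorname{tr}(X^\top Y)$; $X\succeq\mathbf 0$ means $X$ is (symmetric) positive semidefinite; $\operatorname{diag}(X)$ is the vector of diagonal entries of $X$. Two optimization problems are called equivalent if every feasible solution of either one yields a feasible solution of the other with the same objective value. *)

theory Defs
  imports "Jordan_Normal_Form.Matrix"
begin

text \<open>Minimization problems: a feasible set together with the objective to be minimized over it.\<close>

record 'a min_problem =
  feasible :: "'a set"
  objective :: "'a \<Rightarrow> real"

definition equivalent_problems :: "'a min_problem \<Rightarrow> 'b min_problem \<Rightarrow> bool" where
  "equivalent_problems P R \<longleftrightarrow>
     (\<forall>x\<in>feasible P. \<exists>y\<in>feasible R. objective R y = objective P x) \<and>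
     (\<forall>y\<in>feasible R. \<exists>x\<in>feasible P. objective P x = objective R y)"

definition sym_mats :: "nat \<Rightarrow> real mat set" where
  "sym_mats n = {A \<in> carrier_mat n n. transpose_mat A = A}"

definition psd :: "nat \<Rightarrow> real mat \<Rightarrow> bool" where
  "psd n A \<longleftrightarrow> A \<in> sym_mats n \<and> (\<forall>v\<in>carrier_vec n. v \<bullet> (A *\<^sub>v v) \<ge> 0)"

definition mat_trace :: "real mat \<Rightarrow> real" where
  "mat_trace A = sum_list (diag_mat A)"

definition mat_inner :: "real mat \<Rightarrow> real mat \<Rightarrow> real" where
  "mat_inner A B = mat_trace (transpose_mat A * B)"

definition binary_vecs :: "nat \<Rightarrow> real vec set" where
  "binary_vecs n = {x \<in> carrier_vec n. \<forall>i<n. x $ i \<in> {0, 1}}"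

definition bordered_mat :: "nat \<Rightarrow> real vec \<Rightarrow> real mat \<Rightarrow> real mat" where
  "bordered_mat n x X =
     four_block_mat (1\<^sub>m 1) (transpose_mat (mat_of_cols n [x]))
                    (mat_of_cols n [x]) X"

text \<open>In both problems the data of the objective are \<open>Q 0\<close> and \<open>c 0\<close>; the inequality
  constraints are indexed by \<open>{1..m}\<close> and the equations by \<open>{1..p}\<close>.\<close>

definition QCQP ::
  "nat \<Rightarrow> nat \<Rightarrow> nat \<Rightarrow> (nat \<Rightarrow> real mat) \<Rightarrow> (nat \<Rightarrow> real vec) \<Rightarrow> (nat \<Rightarrow> real) \<Rightarrow>
   (nat \<Rightarrow> real vec) \<Rightarrow> (nat \<Rightarrow> real) \<Rightarrow> real vec min_problem" where
  "QCQP n m p Q c d a b =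
     \<lparr> feasible = {x. x \<in> binary_vecs n \<and>
                      (\<forall>i\<in>{1..m}. x \<bullet> (Q i *\<^sub>v x) + c i \<bullet> x \<le> d i) \<and>
                      (\<forall>i\<in>{1..p}. a i \<bullet> x = b i)},
       objective = (\<lambda>x. x \<bullet> (Q 0 *\<^sub>v x) + c 0 \<bullet> x) \<rparr>"

definition BSDP_QCQP ::
  "nat \<Rightarrow> nat \<Rightarrow> nat \<Rightarrow> (nat \<Rightarrow> real mat) \<Rightarrow> (nat \<Rightarrow> real vec) \<Rightarrow> (nat \<Rightarrow> real) \<Rightarrow>
   (nat \<Rightarrow> real vec) \<Rightarrow> (nat \<Rightarrow> real) \<Rightarrow> (real vec \<times> real mat) min_problem" where
  "BSDP_QCQP n m p Q c d a b =
     \<lparr> feasible = {(x, X). x \<in> carrier_vec n \<and> X \<in> sym_mats n \<and>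
                      (\<forall>i\<in>{1..m}. mat_inner (Q i) X + c i \<bullet> x \<le> d i) \<and>
                      (\<forall>i\<in>{1..p}. a i \<bullet> x = b i) \<and>
                      psd (n + 1) (bordered_mat n x X) \<and>
                      vec_of_list (diag_mat X) = x \<and>
                      x \<in> binary_vecs n},
       objective = (\<lambda>(x, X). mat_inner (Q 0) X + c 0 \<bullet> x) \<rparr>"

end

(* For a binary vector x the constraints force X = x x^T. Completing the square in the border
   variable turns positive semidefiniteness of the bordered matrix into that of X - x x^T, whose
   diagonal x_i - x_i^2 vanishes; a positive semidefinite matrix with zero diagonal is zero. *)

theory Submission
  imports Defs
begin

lemma quadratic_form_eq_sum:
  fixes A :: "real mat"
  assumes "A \<in> carrier_mat k k" "v \<in> carrier_vec k"
  shows "v \<bullet> (A *\<^sub>v v) = (\<Sum>i<k. \<Sum>j<k. v $ i * A $$ (i, j) * v $ j)"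
  using assms
  by (auto simp: scalar_prod_def mult_mat_vec_def sum_distrib_left atLeast0LessThan mult.assoc
      intro!: sum.cong)

lemma mat_inner_eq_sum:
  assumes "A \<in> carrier_mat n n" "B \<in> carrier_mat n n"
  shows "mat_inner A B = (\<Sum>i<n. \<Sum>j<n. A $$ (i, j) * B $$ (i, j))"
proof -
  have "mat_inner A B = (\<Sum>j<n. \<Sum>i<n. A $$ (i, j) * B $$ (i, j))"
    using assms
    by (auto simp: mat_inner_def mat_trace_def diag_mat_def interv_sum_list_conv_sum_set_nat
        scalar_prod_def atLeast0LessThan intro!: sum.cong)
  also have "\<dots> = (\<Sum>i<n. \<Sum>j<n. A $$ (i, j) * B $$ (i, j))" by (rule sum.swap)
  finally show ?thesis .
qed

text \<open>Both sides are the sum of \<open>A $$ (i, j) * x $ i * x $ j\<close>. This is what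
  carries objective and inequality values across between the two problems.\<close>

lemma mat_inner_rank_one:
  assumes "A \<in> carrier_mat n n" "x \<in> carrier_vec n"
  shows "mat_inner A (mat n n (\<lambda>(i, j). x $ i * x $ j)) = x \<bullet> (A *\<^sub>v x)"
  using assms by (simp add: mat_inner_eq_sum quadratic_form_eq_sum mult_ac)

lemma bordered_mat_carrier:
  assumes "X \<in> carrier_mat n n"
  shows "bordered_mat n x X \<in> carrier_mat (Suc n) (Suc n)"
  using assms by (auto simp: bordered_mat_def)

text \<open>Index 0 is the border, so coordinate \<open>i\<close> of \<open>x\<close> sits at
  \<open>Suc i\<close>. This form fits \<open>sum.lessThan_Suc_shift\<close>, which splits the first
  term off a sum.\<close>

lemma bordered_mat_index:
  assumes "x \<in> carrier_vec n" "X \<in> carrier_mat n n"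
  shows "bordered_mat n x X $$ (0, 0) = 1"
    and "i < n \<Longrightarrow> bordered_mat n x X $$ (0, Suc i) = x $ i"
    and "i < n \<Longrightarrow> bordered_mat n x X $$ (Suc i, 0) = x $ i"
    and "i < n \<Longrightarrow> j < n \<Longrightarrow> bordered_mat n x X $$ (Suc i, Suc j) = X $$ (i, j)"
  using assms by (auto simp: bordered_mat_def mat_of_cols_def)

lemma bordered_mat_sym:
  assumes "x \<in> carrier_vec n" "X \<in> sym_mats n"
  shows "bordered_mat n x X \<in> sym_mats (Suc n)"
proof -
  have X: "X \<in> carrier_mat n n" and T: "transpose_mat X = X"
    using assms by (auto simp: sym_mats_def)
  have "transpose_mat (bordered_mat n x X) = bordered_mat n x X"
    unfolding bordered_mat_def
    by (subst transpose_four_block_mat[of _ 1 1 _ n _ n]) (use X T in auto)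
  then show ?thesis
    using bordered_mat_carrier[OF X] by (simp add: sym_mats_def)
qed

text \<open>Splitting index 0 off both sums separates corner, border and block; the border row and
  the border column contribute equally, hence the factor 2.\<close>

lemma bordered_mat_quadratic_form:
  assumes x: "x \<in> carrier_vec n" and X: "X \<in> carrier_mat n n" and v: "v \<in> carrier_vec (Suc n)"
  shows "v \<bullet> (bordered_mat n x X *\<^sub>v v) =
    (v $ 0)\<^sup>2 + 2 * v $ 0 * (\<Sum>i<n. v $ Suc i * x $ i)
      + (\<Sum>i<n. \<Sum>j<n. v $ Suc i * X $$ (i, j) * v $ Suc j)"
  unfolding quadratic_form_eq_sum[OF bordered_mat_carrier[OF X] v]
  by (simp add: sum.lessThan_Suc_shift bordered_mat_index[OF x X] sum.distrib
      power2_eq_square sum_distrib_left mult_ac del: sum.lessThan_Suc)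

text \<open>With X = x x^T the bordered matrix is itself the rank-one matrix of the vector (1, x),
  so its form at \<open>v\<close> is the square of the inner product of \<open>v\<close> with (1,
  x).\<close>

lemma psd_bordered_rank_one:
  assumes x: "x \<in> carrier_vec n"
  shows "psd (Suc n) (bordered_mat n x (mat n n (\<lambda>(i, j). x $ i * x $ j)))"
    (is "psd _ (bordered_mat _ _ ?X)")
  unfolding psd_def
proof (intro conjI ballI)
  have "?X \<in> sym_mats n" by (auto simp: sym_mats_def mult.commute)
  then show "bordered_mat n x ?X \<in> sym_mats (Suc n)" by (rule bordered_mat_sym[OF x])
next
  fix v :: "real vec" assume v: "v \<in> carrier_vec (Suc n)"
  let ?s = "\<Sum>i<n. v $ Suc i * x $ i"
  have "(\<Sum>i<n. \<Sum>j<n. v $ Suc i * ?X $$ (i, j) * v $ Suc j) = ?s * ?s"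
    unfolding sum_product by (auto intro!: sum.cong)
  then have "v \<bullet> (bordered_mat n x ?X *\<^sub>v v) = (v $ 0 + ?s)\<^sup>2"
    using bordered_mat_quadratic_form[OF x _ v, of ?X]
    by (simp add: power2_eq_square algebra_simps)
  then show "0 \<le> v \<bullet> (bordered_mat n x ?X *\<^sub>v v)" by simp
qed

lemma psd_bordered_binary_imp_rank_one:
  assumes bin: "x \<in> binary_vecs n" and sym: "X \<in> sym_mats n"
    and psd: "psd (Suc n) (bordered_mat n x X)" and diag: "vec_of_list (diag_mat X) = x"
  shows "X = mat n n (\<lambda>(i, j). x $ i * x $ j)"
proof -
  have x: "x \<in> carrier_vec n" using bin by (simp add: binary_vecs_def)
  have X: "X \<in> carrier_mat n n" and T: "transpose_mat X = X"
    using sym by (auto simp: sym_mats_def)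
  have dg: "X $$ (i, i) = x $ i" if "i < n" for i
    using that X by (simp add: diag[symmetric] diag_mat_def vec_of_list_index)
  \<comment> \<open>Binarity enters here: together with \<open>dg\<close> it makes the diagonal of X
    - x x^T vanish.\<close>
  have sq: "x $ i * x $ i = x $ i" if "i < n" for i
    using that bin by (auto simp: binary_vecs_def)
  have "X $$ (i, j) = x $ i * x $ j" if i: "i < n" and j: "j < n" for i j
  proof -
    have ji: "X $$ (j, i) = X $$ (i, j)"
      using index_transpose_mat(1)[of i X j] X T i j by simp
    (* Test vector (t, e_i + s e_j), with t minimizing the form for given x and s. *)
    have nonneg: "0 \<le> s * (X $$ (i, j) - x $ i * x $ j)" if s: "s * s = 1" for s :: real
    proof -
      define t where "t = - (x $ i + s * x $ j)"
      \<comment> \<open>Adding two indicators also covers \<open>i = j\<close>, where the vector is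
        (1 + s) e_i.\<close>
      define u where "u k = of_bool (k = i) + s * of_bool (k = j)" for k
      define v where "v = vec (Suc n) (case_nat t u)"
      have v: "v \<in> carrier_vec (Suc n)" "v $ 0 = t" "\<And>k. k < n \<Longrightarrow> v $ Suc k = u k"
        by (auto simp: v_def)
      have pick: "(\<Sum>k<n. u k * f k) = f i + s * f j" for f :: "nat \<Rightarrow> real"
      proof -
        have "(\<Sum>k<n. u k * f k) =
            (\<Sum>k<n. if k = i then f k else 0) + s * (\<Sum>k<n. if k = j then f k else 0)"
          unfolding sum_distrib_left sum.distrib[symmetric]
          by (intro sum.cong) (auto simp: u_def algebra_simps)
        then show ?thesis using i j by simp
      qed
      have "0 \<le> v \<bullet> (bordered_mat n x X *\<^sub>v v)"
        using psd v(1) by (simp add: psd_def)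
      also have "\<dots> = t\<^sup>2 + 2 * t * (\<Sum>k<n. u k * x $ k)
          + (\<Sum>k<n. u k * (\<Sum>l<n. u l * X $$ (k, l)))"
        by (simp add: bordered_mat_quadratic_form[OF x X v(1)] v sum_distrib_left mult_ac)
      \<comment> \<open>\<open>pick\<close> evaluates the inner sum over \<open>l\<close> first and
        then the outer sum over \<open>k\<close>.\<close>
      also have "\<dots> = t\<^sup>2 + 2 * t * (x $ i + s * x $ j)
          + (x $ i + s * X $$ (i, j) + s * (X $$ (i, j) + s * x $ j))"
        by (simp only: pick dg[OF i] dg[OF j] ji)
      \<comment> \<open>For this \<open>t\<close> the terms containing \<open>t\<close> collapse to
        -(x_i + s x_j)^2, which leaves the form of X - x x^T at e_i + s e_j: two diagonal terms,
        which \<open>sq\<close> cancels, and the cross term.\<close>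
      also have "\<dots> = x $ i - x $ i * x $ i + s * s * (x $ j - x $ j * x $ j)
          + 2 * (s * (X $$ (i, j) - x $ i * x $ j))"
        unfolding t_def by (simp add: power2_eq_square algebra_simps)
      finally show ?thesis by (simp add: sq[OF i] sq[OF j])
    qed
    \<comment> \<open>The two signs bound X_ij - x_i x_j by 0 from below and from above.\<close>
    show ?thesis using nonneg[of 1] nonneg[of "-1"] by simp
  qed
  then show ?thesis using X by auto
qed

theorem theorem9:
  fixes n m p :: nat
    and Q :: "nat \<Rightarrow> real mat" and c :: "nat \<Rightarrow> real vec" and d :: "nat \<Rightarrow> real"
    and a :: "nat \<Rightarrow> real vec" and b :: "nat \<Rightarrow> real"
  assumes "Q 0 \<in> sym_mats n" and "\<And>i. i \<in> {1..m} \<Longrightarrow> Q i \<in> sym_mats n"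
    and "c 0 \<in> carrier_vec n" and "\<And>i. i \<in> {1..m} \<Longrightarrow> c i \<in> carrier_vec n"
    and "\<And>i. i \<in> {1..p} \<Longrightarrow> a i \<in> carrier_vec n"
  shows "equivalent_problems (BSDP_QCQP n m p Q c d a b) (QCQP n m p Q c d a b)"
proof -
  let ?P = "BSDP_QCQP n m p Q c d a b" and ?R = "QCQP n m p Q c d a b"
  \<comment> \<open>\<open>?L x\<close> is the only matrix that can accompany a feasible
    \<open>x\<close>, so \<open>x\<close> and \<open>(x, ?L x)\<close> correspond one to
    one.\<close>
  let ?L = "\<lambda>x::real vec. mat n n (\<lambda>(i, j). x $ i * x $ j)"
  have Q: "mat_inner (Q i) (?L x) = x \<bullet> (Q i *\<^sub>v x)"
    if "i = 0 \<or> i \<in> {1..m}" "x \<in> binary_vecs n" for i x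
    using that assms(1,2) by (intro mat_inner_rank_one) (auto simp: sym_mats_def binary_vecs_def)
  have lift: "(x, ?L x) \<in> feasible ?P" if "x \<in> feasible ?R" for x
  proof -
    have bin: "x \<in> binary_vecs n" and x: "x \<in> carrier_vec n"
      using that by (auto simp: QCQP_def binary_vecs_def)
    \<comment> \<open>The diagonal entries are x_i^2, which equal x_i for entries in {0, 1}.\<close>
    have "vec_of_list (diag_mat (?L x)) = x"
      using bin by (intro eq_vecI) (auto simp: diag_mat_def vec_of_list_index binary_vecs_def)
    moreover have "?L x \<in> sym_mats n" by (auto simp: sym_mats_def mult.commute)
    ultimately show ?thesis
      using that x bin psd_bordered_rank_one[OF x] Q[OF _ bin]
      by (auto simp: QCQP_def BSDP_QCQP_def)
  qed
  have drop: "x \<in> feasible ?R \<and> X = ?L x" if "(x, X) \<in> feasible ?P" for x X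
  proof -
    have f: "x \<in> binary_vecs n" "X \<in> sym_mats n" "psd (Suc n) (bordered_mat n x X)"
        "vec_of_list (diag_mat X) = x"
        "\<forall>i\<in>{1..m}. mat_inner (Q i) X + c i \<bullet> x \<le> d i" "\<forall>i\<in>{1..p}. a i \<bullet> x = b i"
      using that by (simp_all add: BSDP_QCQP_def)
    have X: "X = ?L x" using f(1-4) by (rule psd_bordered_binary_imp_rank_one)
    moreover have "x \<in> feasible ?R"
      using f(1,5,6) Q[OF _ f(1)] by (simp add: QCQP_def X)
    ultimately show ?thesis by simp
  qed
  have obj: "objective ?P (x, ?L x) = objective ?R x" if "x \<in> feasible ?R" for x
    using that Q[of 0 x] by (simp add: QCQP_def BSDP_QCQP_def)
  show ?thesis
    unfolding equivalent_problems_def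
  proof (intro conjI ballI)
    fix z assume z: "z \<in> feasible ?P"
    obtain x X where "z = (x, X)" by (cases z)
    with drop[of x X] z have "x \<in> feasible ?R" "z = (x, ?L x)" by simp_all
    then show "\<exists>y\<in>feasible ?R. objective ?R y = objective ?P z"
      using obj[of x] by metis
  next
    fix y assume "y \<in> feasible ?R"
    then show "\<exists>z\<in>feasible ?P. objective ?P z = objective ?R y"
      using lift obj by blast
  qed
qed

end
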